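(* Let $G$ be a connected graph on $n\geq 5$ vertices. Then $\eta_1(G)\geq\eta_1(P_n)$, with equality if and only if $G\cong P_n$ (the path on $n$ vertices). If $G\not\cong P_n$, then $\eta_1(G)\geq \eta_1(C_n)=2$, with equality if and only if $G\cong C_n$ (the cycle on $n$ vertices).
   Context: For a simple graph $G$ with vertex set $\{v_1,\dots,v_n\}$ and no isolated vertices, let $d_i$ denote the degree of $v_i$. The extended adjacency matrix $A_{ex}(G)=(a^{ex}_{ij})$ is the $n\times n$ matrix with $a^{ex}_{ij}=\frac12\left(\frac{d_i}{d_j}+\frac{d_j}{d_i}\right)$ if $v_iv_j$ is an edge of $G$ and $a^{ex}_{ij}=0$ otherwise. The extended spectral radius $\eta_1(G)$ is the largest eigenvalue of $A_{ex}(G)$. *)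

theory Defs
  imports "Graph_Theory.Graph_Theory" "Jordan_Normal_Form.Char_Poly"
begin

text \<open>
  Simple graphs are rendered as in the session \<^verbatim>\<open>Graph_Theory\<close>: \<^term>\<open>pair_graph G\<close> says that
  the vertex set is finite and the arcs form an irreflexive symmetric relation on it, so that an
  edge \<open>uv\<close> corresponds to the two arcs \<open>(u, v)\<close> and \<open>(v, u)\<close>. Hence \<^const>\<open>out_degree\<close> is the
  degree, and \<^const>\<open>digraph_iso\<close> is isomorphism of simple graphs.
\<close>

text \<open>
  The enumeration \<open>v 0, \<dots>, v (n - 1)\<close> of the vertices plays the role of the labelling
  \<open>v\<^sub>1, \<dots>, v\<^sub>n\<close>; it is meant to be a bijection from \<open>{..<n}\<close> onto the vertex set.
\<close>

definition ext_adj_mat :: "(nat \<Rightarrow> 'a) \<Rightarrow> 'a pair_pre_digraph \<Rightarrow> real mat" where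
  "ext_adj_mat v G =
    mat (card (pverts G)) (card (pverts G)) (\<lambda>(i, j).
      if (v i, v j) \<in> parcs G
      then (real (out_degree G (v i)) / real (out_degree G (v j)) +
            real (out_degree G (v j)) / real (out_degree G (v i))) / 2
      else 0)"

text \<open>
  The matrix is real symmetric for a simple graph, so all its eigenvalues are real and
  it suffices to range over the reals.
\<close>

definition ext_spectral_radius :: "(nat \<Rightarrow> 'a) \<Rightarrow> 'a pair_pre_digraph \<Rightarrow> real" where
  "ext_spectral_radius v G = Max {k. eigenvalue (ext_adj_mat v G) k}"

definition path_graph :: "nat \<Rightarrow> nat pair_pre_digraph" where
  "path_graph n =
    \<lparr>pverts = {..<n}, parcs = {(i, j). i < n \<and> j < n \<and> (j = Suc i \<or> i = Suc j)}\<rparr>"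

text \<open>A simple graph only for \<open>n \<noteq> 1\<close>, and the cycle on \<open>n\<close> vertices for \<open>n \<ge> 3\<close>.\<close>

definition cycle_graph :: "nat \<Rightarrow> nat pair_pre_digraph" where
  "cycle_graph n =
    \<lparr>pverts = {..<n}, parcs = {(i, j). i < n \<and> j < n \<and> (j = Suc i mod n \<or> i = Suc j mod n)}\<rparr>"

lemma pair_graph_path_graph: "pair_graph (path_graph n)"
proof -
  have "finite (parcs (path_graph n))"
    by (rule finite_subset[of _ "{..<n} \<times> {..<n}"]) (auto simp: path_graph_def)
  then show ?thesis
    by unfold_locales (auto simp: path_graph_def symmetric_def arcs_ends_def arc_to_ends_def sym_def)
qed

lemma pair_graph_cycle_graph:
  assumes "n \<ge> 3"
  shows "pair_graph (cycle_graph n)"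
proof -
  have "finite (parcs (cycle_graph n))"
    by (rule finite_subset[of _ "{..<n} \<times> {..<n}"]) (auto simp: cycle_graph_def)
  moreover have "Suc i mod n \<noteq> i" "i \<noteq> Suc i mod n" if "i < n" for i
    using that assms by (cases "Suc i = n"; auto)+
  ultimately show ?thesis
    by unfold_locales
      (auto simp: cycle_graph_def symmetric_def arcs_ends_def arc_to_ends_def sym_def)
qed

end

theory Submission
  imports Defs "HOL-Analysis.Function_Topology"
begin

text \<open>
  A connected graph of maximal degree at most 2 is a path or a cycle. If some degree is at least 3,
  the vector that is 1 on non-leaves and 5/8 on leaves has Rayleigh quotient greater than 2: every
  edge weight is at least 1, a pendant edge has weight at least 5/4, and the resulting inequality
  follows from \<open>m \<ge> n - 1\<close> together with the bound \<open>2 (n - m) + 1\<close> from below for the number of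
  leaves. The cycle is regular, so its extended spectral radius is 2, and an explicit positive vector
  \<open>y\<close> with \<open>A y < 2 y\<close> shows that the radius of the path is smaller than 2.
\<close>


text \<open>The value 2 separates three classes strictly: the path lies below it, the cycle on it,
  every other graph above it. Since isomorphic graphs have equal radii, this separation yields both
  inequalities and both equality cases. The tight case is a tree with three leaves. Put t = 2m - 2n,
  so t >= -2. Giving all L leaves the value s, and 1 to the other vertices, changes the lower bound
  for the quadratic form by 5/2 s - 2 per leaf and the squared norm by s^2 - 1. Hence form minus
  twice squared norm is at least t + (5/2 s - 2 s^2) L. The constant vector s = 1 gains only 1/2 per
  leaf, which leaves -1/2 at t = -2, L = 3. The gain is largest at s = 5/8, where it is 25/32, and
  together with L >= 1 - t this makes the bound positive. The extra weight of edges between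
  non-leaves of different degrees is simply dropped. A single test vector bounds the largest
  eigenvalue from below through its Rayleigh quotient; bounds from above come from positive vectors
  and an inequality in every coordinate.\<close>

section \<open>Rayleigh quotients and positive test vectors for kernels on a finite set\<close>

text \<open>Vectors are functions on the whole type, so they are forced to vanish off
  \<open>V\<close>. The sphere is then a closed part of a product of intervals and singletons, which
  is compact by Tychonoff.\<close>

lemma compact_unit_sphere_fun:
  fixes V :: "'a set"
  assumes "finite V"
  shows "compact {x :: 'a \<Rightarrow> real. (\<forall>u. u \<notin> V \<longrightarrow> x u = 0) \<and> (\<Sum>u\<in>V. (x u)\<^sup>2) = 1}"
    (is "compact ?S")
proof -
  define B where "B = PiE UNIV (\<lambda>u. if u \<in> V then {-1..1::real} else {0})"
  have "compactin (product_topology (\<lambda>_. euclidean) UNIV) B"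
    unfolding B_def compactin_PiE by auto
  then have "compact B"
    by (simp add: euclidean_product_topology)
  moreover have "closed {x :: 'a \<Rightarrow> real. (\<Sum>u\<in>V. (x u)\<^sup>2) = 1}"
    by (intro closed_Collect_eq continuous_intros continuous_on_product_coordinates)
  ultimately have "compact (B \<inter> {x. (\<Sum>u\<in>V. (x u)\<^sup>2) = 1})"
    by (rule compact_Int_closed)
  also have "B \<inter> {x. (\<Sum>u\<in>V. (x u)\<^sup>2) = 1} = ?S"
  proof (intro equalityI subsetI)
    fix x assume x: "x \<in> ?S"
    have "\<bar>x u\<bar> \<le> 1" if "u \<in> V" for u
    proof -
      have "(x u)\<^sup>2 \<le> (\<Sum>u\<in>V. (x u)\<^sup>2)"
        using assms that by (intro member_le_sum) auto
      with x show ?thesis by (simp add: abs_square_le_1)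
    qed
    with x show "x \<in> B \<inter> {x. (\<Sum>u\<in>V. (x u)\<^sup>2) = 1}"
      by (force simp: B_def abs_le_iff)
  next
    fix x assume "x \<in> B \<inter> {x. (\<Sum>u\<in>V. (x u)\<^sup>2) = 1}"
    then have s: "(\<Sum>u\<in>V. (x u)\<^sup>2) = 1" and b: "\<And>u. x u \<in> (if u \<in> V then {-1..1::real} else {0})"
      by (auto simp: B_def PiE_iff)
    have "x u = 0" if "u \<notin> V" for u using b[of u] that by simp
    with s show "x \<in> ?S" by simp
  qed
  finally show ?thesis .
qed

text \<open>The quadratic vanishes at 0 and so has its minimum there, which kills its slope. This is
  the first-order condition for the maximum of the Rayleigh quotient.\<close>

lemma quadratic_nonneg_imp_linear_coeff_zero:
  fixes b c :: real
  assumes "\<And>t. 0 \<le> 2 * t * b + t\<^sup>2 * c"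
  shows "b = 0"
proof -
  have c: "c \<ge> 0"
    using assms[of 1] assms[of "-1"] by simp
  \<comment> \<open>The summand 1 keeps the denominator positive when \<open>c = 0\<close>; at this
    \<open>t\<close> the quadratic equals \<open>- (t\<^sup>2 * (c + 2))\<close>.\<close>
  define t where "t = - b / (c + 1)"
  have b: "b = - t * (c + 1)"
    using c by (simp add: t_def)
  have "0 \<le> - (t\<^sup>2 * (c + 2))"
    using assms[of t] unfolding b by (simp add: algebra_simps power2_eq_square)
  then have "t = 0"
    using c by (simp add: mult_le_0_iff)
  with b show ?thesis by simp
qed

lemma sum_mult_indicator_left:
  fixes f :: "'a \<Rightarrow> real"
  assumes "finite V" "u \<in> V"
  shows "(\<Sum>w\<in>V. f w * (if w = u then 1 else 0)) = f u"
  using assms by (simp add: if_distrib cong: if_cong)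

text \<open>The quadratic form attains its maximum \<open>k\<close> on the unit sphere, and varying
  a maximiser in each coordinate direction shows that it is an eigenvector for \<open>k\<close>.
  Homogeneity extends the bound from the sphere to all \<open>y\<close>.\<close>

lemma symmetric_kernel_max_eigenvector:
  fixes a :: "'a \<Rightarrow> 'a \<Rightarrow> real"
  assumes fin: "finite V" and ne: "V \<noteq> {}"
    and sym: "\<And>u w. u \<in> V \<Longrightarrow> w \<in> V \<Longrightarrow> a u w = a w u"
  obtains k x where "\<exists>u\<in>V. x u \<noteq> 0" "\<And>u. u \<in> V \<Longrightarrow> (\<Sum>w\<in>V. a u w * x w) = k * x u"
    "\<And>y. (\<Sum>u\<in>V. y u * (\<Sum>w\<in>V. a u w * y w)) \<le> k * (\<Sum>u\<in>V. (y u)\<^sup>2)"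
proof -
  define Q where "Q y = (\<Sum>u\<in>V. y u * (\<Sum>w\<in>V. a u w * y w))" for y
  define N where "N y = (\<Sum>u\<in>V. (y u)\<^sup>2)" for y :: "'a \<Rightarrow> real"
  define S where "S = {x. (\<forall>u. u \<notin> V \<longrightarrow> x u = 0) \<and> N x = 1}"
  have "compact S"
    unfolding S_def N_def by (rule compact_unit_sphere_fun[OF fin])
  moreover obtain r where r: "r \<in> V" using ne by auto
  have "(\<lambda>u. if u = r then 1 else 0) \<in> S"
    using r fin by (auto simp: S_def N_def if_distrib[of "\<lambda>t. t\<^sup>2"] cong: if_cong)
  then have "S \<noteq> {}" by auto
  moreover have "continuous_on S Q"
    unfolding Q_def
    by (intro continuous_intros continuous_on_subset[OF continuous_on_product_coordinates]) auto
  ultimately obtain x where x: "x \<in> S" and xmax: "\<And>y. y \<in> S \<Longrightarrow> Q y \<le> Q x"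
    using continuous_attains_sup by metis
  define k where "k = Q x"
  have Nx: "N x = 1" using x by (simp add: S_def)
  have le: "Q y \<le> k * N y" for y
  proof (cases "N y = 0")
    case True
    then have "\<And>u. u \<in> V \<Longrightarrow> y u = 0"
      using fin by (simp add: N_def sum_nonneg_eq_0_iff)
    then show ?thesis by (simp add: True Q_def)
  next
    case False
    then have pos: "N y > 0" by (simp add: N_def order.not_eq_order_implies_strict sum_nonneg)
    define z where "z u = (if u \<in> V then y u / sqrt (N y) else 0)" for u
    have Nz: "N z = N y / (sqrt (N y))\<^sup>2"
      by (simp add: N_def z_def power_divide flip: sum_divide_distrib)
    have Qz: "Q z = Q y / (sqrt (N y))\<^sup>2"
      by (simp add: Q_def z_def power2_eq_square flip: sum_divide_distrib)
    have "z \<in> S" using pos Nz by (auto simp: S_def z_def)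
    then have "Q z \<le> k" unfolding k_def by (rule xmax)
    then have "Q z * N y \<le> k * N y" using pos by simp
    with Qz pos show ?thesis by simp
  qed
  have "(\<Sum>w\<in>V. a u w * x w) = k * x u" if u: "u \<in> V" for u
  proof -
    define e where "e w = (if w = u then 1 else 0 :: real)" for w
    define b where "b = k * x u - (\<Sum>w\<in>V. a u w * x w)"
    have de: "(\<Sum>w\<in>V. f w * e w) = f u" for f
      unfolding e_def using fin u by (rule sum_mult_indicator_left)
    have de': "(\<Sum>w\<in>V. e w * f w) = f u" for f
      using de[of f] by (simp add: mult.commute)
    have NN: "N (\<lambda>w. x w + t * e w) = N x + 2 * t * x u + t\<^sup>2" for t
    proof -
      have "N (\<lambda>w. x w + t * e w) = N x + 2 * t * (\<Sum>w\<in>V. x w * e w) + t\<^sup>2 * (\<Sum>w\<in>V. e w * e w)"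
        by (simp add: N_def power2_sum sum.distrib sum_distrib_left power_mult_distrib algebra_simps
            power2_eq_square)
      then show ?thesis by (simp add: de e_def[of u])
    qed
    have QQ: "Q (\<lambda>w. x w + t * e w) = Q x + 2 * t * (\<Sum>w\<in>V. a u w * x w) + t\<^sup>2 * a u u" for t
    proof -
      have "(\<Sum>w\<in>V. a v w * (x w + t * e w)) = (\<Sum>w\<in>V. a v w * x w) + t * a v u" for v
      proof -
        have "(\<Sum>w\<in>V. a v w * (x w + t * e w)) = (\<Sum>w\<in>V. a v w * x w) + t * (\<Sum>w\<in>V. a v w * e w)"
          by (simp add: sum.distrib sum_distrib_left algebra_simps)
        then show ?thesis by (simp add: de)
      qed
      then have "Q (\<lambda>w. x w + t * e w) = (\<Sum>v\<in>V. (x v + t * e v) * ((\<Sum>w\<in>V. a v w * x w) + t * a v u))"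
        by (simp add: Q_def)
      also have "\<dots> = Q x + t * (\<Sum>v\<in>V. x v * a v u) + t * (\<Sum>v\<in>V. e v * (\<Sum>w\<in>V. a v w * x w))
          + t\<^sup>2 * (\<Sum>v\<in>V. e v * a v u)"
        unfolding Q_def sum_distrib_left[of t] sum_distrib_left[of "t\<^sup>2"] sum.distrib[symmetric]
        by (intro sum.cong refl) (simp add: algebra_simps power2_eq_square)
      \<comment> \<open>Symmetry of \<open>a\<close> makes the two cross terms equal, hence the
        factor 2 in the linear coefficient.\<close>
      also have "(\<Sum>v\<in>V. x v * a v u) = (\<Sum>w\<in>V. a u w * x w)"
        using u by (intro sum.cong refl) (simp add: sym mult.commute)
      finally show ?thesis by (simp add: de')
    qed
    \<comment> \<open>This is \<open>k * N - Q\<close> along the line \<open>x + t * e\<close>; its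
      constant term vanishes because \<open>x\<close> attains the maximum.\<close>
    have "0 \<le> 2 * t * b + t\<^sup>2 * (k - a u u)" for t
      using le[of "\<lambda>w. x w + t * e w"] unfolding NN QQ Nx k_def[symmetric] b_def
      by (simp add: algebra_simps)
    then have "b = 0" by (rule quadratic_nonneg_imp_linear_coeff_zero)
    then show ?thesis by (simp add: b_def)
  qed
  moreover have "\<exists>u\<in>V. x u \<noteq> 0"
  proof (rule ccontr)
    assume "\<not> ?thesis"
    then have "N x = 0" by (simp add: N_def)
    with Nx show False by simp
  qed
  ultimately show thesis
    using that le unfolding Q_def N_def by blast
qed

text \<open>Collatz-Wielandt bound: let \<open>m\<close> be the largest ratio of
  \<open>\<bar>x u\<bar>\<close> to \<open>y u\<close>. Then \<open>\<bar>x\<bar>\<close> is at most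
  \<open>m * y\<close> everywhere, with equality at a maximising \<open>u\<close>, and the
  eigenvalue equation at \<open>u\<close> can be compared with the row of \<open>y\<close>.
  Consequently a positive \<open>y\<close> whose rows all stay below \<open>c * y\<close> keeps
  every real eigenvalue below \<open>c\<close>.\<close>

lemma nonneg_kernel_eigenvalue_bound:
  fixes a :: "'a \<Rightarrow> 'a \<Rightarrow> real"
  assumes fin: "finite V" and nn: "\<And>u w. u \<in> V \<Longrightarrow> w \<in> V \<Longrightarrow> 0 \<le> a u w"
    and ypos: "\<And>u. u \<in> V \<Longrightarrow> 0 < y u"
    and ex: "\<exists>u\<in>V. x u \<noteq> 0" and ev: "\<And>u. u \<in> V \<Longrightarrow> (\<Sum>w\<in>V. a u w * x w) = k * x u"
  obtains u where "u \<in> V" "k * y u \<le> (\<Sum>w\<in>V. a u w * y w)"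
proof -
  define m where "m = Max ((\<lambda>u. \<bar>x u\<bar> / y u) ` V)"
  have "V \<noteq> {}" using ex by auto
  then have "m \<in> (\<lambda>u. \<bar>x u\<bar> / y u) ` V"
    unfolding m_def using fin by (intro Max_in) auto
  then obtain u where u: "u \<in> V" "m = \<bar>x u\<bar> / y u" by auto
  have le: "\<bar>x w\<bar> \<le> m * y w" if "w \<in> V" for w
  proof -
    have "\<bar>x w\<bar> / y w \<le> m" unfolding m_def using fin that by (intro Max_ge) auto
    with ypos[OF that] show ?thesis by (simp add: field_simps)
  qed
  obtain r where r: "r \<in> V" "x r \<noteq> 0" using ex by auto
  have mpos: "m > 0"
    using le[OF r(1)] r ypos[OF r(1)] by (smt (verit) mult_nonpos_nonneg)
  have xu: "\<bar>x u\<bar> = m * y u" using u ypos[of u] by simp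
  have "k * (m * y u) \<le> \<bar>k * x u\<bar>"
    by (metis xu abs_mult abs_ge_self mult_right_mono abs_ge_zero)
  also have "\<dots> \<le> (\<Sum>w\<in>V. \<bar>a u w * x w\<bar>)"
    unfolding ev[OF u(1), symmetric] by (rule sum_abs)
  also have "\<dots> \<le> (\<Sum>w\<in>V. a u w * (m * y w))"
    using nn[OF u(1)] le by (intro sum_mono) (simp add: abs_mult mult_left_mono)
  also have "\<dots> = m * (\<Sum>w\<in>V. a u w * y w)"
    by (simp add: sum_distrib_left mult_ac)
  finally have "m * (k * y u) \<le> m * (\<Sum>w\<in>V. a u w * y w)" by (simp add: mult_ac)
  then have "k * y u \<le> (\<Sum>w\<in>V. a u w * y w)"
    by (rule mult_left_le_imp_le[OF _ mpos])
  with u(1) show thesis by (rule that)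
qed

section \<open>Degrees and isomorphism of pair digraphs\<close>

lemma out_degree_eq_card_neighbours:
  "out_degree (with_proj G) u = card {w. (u, w) \<in> parcs G}"
proof -
  have "out_arcs (with_proj G) u = Pair u ` {w. (u, w) \<in> parcs G}"
    by (auto simp: out_arcs_def)
  then show ?thesis
    by (simp add: out_degree_def card_image inj_on_def)
qed

text \<open>\<open>digraph_iso\<close> carries separate maps for vertices, arcs, heads and tails.
  When arcs are pairs, the last two are projections and the vertex map \<open>f\<close> forces the
  arc map to be \<open>map_prod f f\<close>, so only \<open>f\<close> remains.\<close>

lemma digraph_iso_pair_iff:
  assumes "pair_wf_digraph G" "pair_wf_digraph H"
  shows "digraph_iso (with_proj G) (with_proj H) \<longleftrightarrow>
    (\<exists>f. bij_betw f (pverts G) (pverts H) \<and>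
      (\<forall>u\<in>pverts G. \<forall>w\<in>pverts G. (u, w) \<in> parcs G \<longleftrightarrow> (f u, f w) \<in> parcs H))"
    (is "?L \<longleftrightarrow> ?R")
proof
  interpret G: pair_wf_digraph G by fact
  interpret H: pair_wf_digraph H by fact
  {
    assume ?L
    then obtain h where h: "pre_digraph.digraph_isomorphism (with_proj G) h"
      and H: "with_proj H = app_iso h (with_proj G)"
      unfolding digraph_iso_def by auto
    have vH: "pverts H = iso_verts h ` pverts G"
      using arg_cong[OF H, of verts] by simp
    have aH: "parcs H = iso_arcs h ` parcs G"
      using arg_cong[OF H, of arcs] by simp
    have tH: "iso_tail h = fst" using arg_cong[OF H, of tail] by simp
    have hH: "iso_head h = snd" using arg_cong[OF H, of head] by simp
    have inj: "inj_on (iso_verts h) (pverts G)"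
      and arc: "\<And>a. a \<in> parcs G \<Longrightarrow> iso_arcs h a = (iso_verts h (fst a), iso_verts h (snd a))"
      using h by (auto simp: G.digraph_isomorphism_def tH hH prod_eq_iff)
    have "(u, w) \<in> parcs G \<longleftrightarrow> (iso_verts h u, iso_verts h w) \<in> parcs H"
      if "u \<in> pverts G" "w \<in> pverts G" for u w
    proof
      assume "(u, w) \<in> parcs G"
      then show "(iso_verts h u, iso_verts h w) \<in> parcs H"
        unfolding aH using arc by force
    next
      assume "(iso_verts h u, iso_verts h w) \<in> parcs H"
      then obtain a where a: "a \<in> parcs G" "iso_verts h (fst a) = iso_verts h u"
        "iso_verts h (snd a) = iso_verts h w"
        unfolding aH using arc by force
      then have "fst a = u" "snd a = w"
        using inj that G.in_arcsD1[of "fst a" "snd a"] G.in_arcsD2[of "fst a" "snd a"]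
        by (auto dest: inj_onD)
      with a show "(u, w) \<in> parcs G" by auto
    qed
    with inj vH show ?R
      by (intro exI[of _ "iso_verts h"]) (auto simp: bij_betw_def)
  }
  {
    assume ?R
    then obtain f where bij: "bij_betw f (pverts G) (pverts H)"
      and arc: "\<And>u w. u \<in> pverts G \<Longrightarrow> w \<in> pverts G \<Longrightarrow> (u, w) \<in> parcs G \<longleftrightarrow> (f u, f w) \<in> parcs H"
      by auto
    have inj: "inj_on f (pverts G)" and im: "f ` pverts G = pverts H"
      using bij by (auto simp: bij_betw_def)
    define h where "h = \<lparr>iso_verts = f, iso_arcs = map_prod f f, iso_head = snd, iso_tail = fst\<rparr>"
    have "inj_on (map_prod f f) (pverts G \<times> pverts G)"
      using inj by (simp add: map_prod_inj_on)
    then have "inj_on (map_prod f f) (parcs G)"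
      by (rule inj_on_subset) (auto dest: G.in_arcsD1 G.in_arcsD2)
    then have "G.digraph_isomorphism h"
      using inj G.wf_digraph_axioms by (auto simp: G.digraph_isomorphism_def h_def)
    moreover have "parcs H = map_prod f f ` parcs G"
    proof (intro equalityI subsetI)
      fix a assume a: "a \<in> parcs H"
      then have "fst a \<in> f ` pverts G" "snd a \<in> f ` pverts G"
        unfolding im by (metis H.in_arcsD1 H.in_arcsD2 prod.collapse)+
      then obtain u w where "u \<in> pverts G" "w \<in> pverts G" "a = (f u, f w)"
        by (metis imageE prod.collapse)
      with a arc show "a \<in> map_prod f f ` parcs G" by (force simp: image_iff)
    next
      fix a assume "a \<in> map_prod f f ` parcs G"
      then obtain u w where uw: "(u, w) \<in> parcs G" "a = (f u, f w)" by auto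
      then have "u \<in> pverts G" "w \<in> pverts G" by (auto dest: G.in_arcsD1 G.in_arcsD2)
      with uw arc show "a \<in> parcs H" by simp
    qed
    then have "with_proj H = app_iso h (with_proj G)"
      by (simp add: app_iso_def h_def with_proj_def im)
    ultimately show ?L
      unfolding digraph_iso_def by blast
  }
qed

section \<open>Eigenvalues indexed by vertices, and invariance under isomorphism\<close>

text \<open>The matrix entry indexed by vertices instead of positions, so that no enumeration enters
  the graph arguments.\<close>

definition ext_weight :: "'a pair_pre_digraph \<Rightarrow> 'a \<Rightarrow> 'a \<Rightarrow> real" where
  "ext_weight G u w =
    (if (u, w) \<in> parcs G
     then (real (out_degree G u) / real (out_degree G w) +
           real (out_degree G w) / real (out_degree G u)) / 2
     else 0)"

definition ext_eigenvalue :: "'a pair_pre_digraph \<Rightarrow> real \<Rightarrow> bool" where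
  "ext_eigenvalue G k \<longleftrightarrow>
    (\<exists>x. (\<exists>u\<in>pverts G. x u \<noteq> 0) \<and>
      (\<forall>u\<in>pverts G. (\<Sum>w\<in>pverts G. ext_weight G u w * x w) = k * x u))"

lemma ext_weight_nonneg: "ext_weight G u w \<ge> 0"
  by (simp add: ext_weight_def)

text \<open>Eigenvectors are carried over by composing with \<open>v\<close> or its inverse, and the
  rows agree after reindexing the sum. The right-hand side does not mention \<open>v\<close>, so the
  spectrum is independent of the enumeration.\<close>

lemma eigenvalue_ext_adj_mat_iff:
  assumes bij: "bij_betw v {..<card (pverts G)} (pverts G)"
  shows "eigenvalue (ext_adj_mat v G) k \<longleftrightarrow> ext_eigenvalue G k"
proof -
  define n where "n = card (pverts G)"
  define A where "A = ext_adj_mat v G"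
  have A: "A \<in> carrier_mat n n"
    by (simp add: A_def ext_adj_mat_def n_def)
  have entry: "A $$ (i, j) = ext_weight G (v i) (v j)" if "i < n" "j < n" for i j
    using that by (simp add: A_def ext_adj_mat_def n_def ext_weight_def)
  have b: "bij_betw v {..<n} (pverts G)" using bij by (simp add: n_def)
  have row: "(A *\<^sub>v z) $ i = (\<Sum>j<n. ext_weight G (v i) (v j) * z $ j)"
    if "i < n" "z \<in> carrier_vec n" for i z
    using that A entry by (auto simp: scalar_prod_def lessThan_atLeast0 intro!: sum.cong)
  have "eigenvalue A k \<longleftrightarrow> (\<exists>z\<in>carrier_vec n. z \<noteq> 0\<^sub>v n \<and> A *\<^sub>v z = k \<cdot>\<^sub>v z)"
    using A by (auto simp: eigenvalue_def eigenvector_def)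
  also have "\<dots> \<longleftrightarrow> ext_eigenvalue G k"
  proof
    assume "\<exists>z\<in>carrier_vec n. z \<noteq> 0\<^sub>v n \<and> A *\<^sub>v z = k \<cdot>\<^sub>v z"
    then obtain z where z: "z \<in> carrier_vec n" "z \<noteq> 0\<^sub>v n" "A *\<^sub>v z = k \<cdot>\<^sub>v z" by auto
    define x where "x u = z $ (the_inv_into {..<n} v u)" for u
    have xv: "x (v i) = z $ i" if "i < n" for i
      using that b by (simp add: x_def bij_betw_def the_inv_into_f_f)
    obtain i where "i < n" "z $ i \<noteq> 0"
      using z(1,2) by (metis carrier_vecD eq_vecI index_zero_vec(1) index_zero_vec(2))
    then have "v i \<in> pverts G" "x (v i) \<noteq> 0" using xv b by (auto simp: bij_betw_def)
    moreover have "(\<Sum>w\<in>pverts G. ext_weight G u w * x w) = k * x u" if "u \<in> pverts G" for u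
    proof -
      obtain i where i: "i < n" "u = v i" using \<open>u \<in> pverts G\<close> b by (auto simp: bij_betw_def)
      have "(\<Sum>w\<in>pverts G. ext_weight G u w * x w) = (\<Sum>j<n. ext_weight G u (v j) * x (v j))"
        by (rule sum.reindex_bij_betw[OF b, symmetric])
      also have "\<dots> = (A *\<^sub>v z) $ i" using i z(1) by (simp add: row xv)
      also have "\<dots> = k * x u" using i z(1) by (simp add: z(3) xv)
      finally show ?thesis .
    qed
    ultimately show "ext_eigenvalue G k" unfolding ext_eigenvalue_def by blast
  next
    assume "ext_eigenvalue G k"
    then obtain x where x: "\<exists>u\<in>pverts G. x u \<noteq> 0"
      and ev: "\<And>u. u \<in> pverts G \<Longrightarrow> (\<Sum>w\<in>pverts G. ext_weight G u w * x w) = k * x u"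
      unfolding ext_eigenvalue_def by blast
    define z where "z = vec n (\<lambda>i. x (v i))"
    have z: "z \<in> carrier_vec n" by (simp add: z_def)
    obtain i where i: "i < n" "x (v i) \<noteq> 0"
      using x unfolding bij_betw_imp_surj_on[OF b, symmetric] by auto
    then have "z $ i \<noteq> 0\<^sub>v n $ i" by (simp add: z_def)
    then have "z \<noteq> 0\<^sub>v n" by auto
    moreover have "A *\<^sub>v z = k \<cdot>\<^sub>v z"
    proof (rule eq_vecI)
      fix i assume "i < dim_vec (k \<cdot>\<^sub>v z)"
      then have i: "i < n" using z by simp
      then have "v i \<in> pverts G" using b by (auto simp: bij_betw_def)
      have "(A *\<^sub>v z) $ i = (\<Sum>j<n. ext_weight G (v i) (v j) * x (v j))"
        using i by (simp add: row[OF i z]) (simp add: z_def)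
      also have "\<dots> = (\<Sum>w\<in>pverts G. ext_weight G (v i) w * x w)"
        by (rule sum.reindex_bij_betw[OF b])
      also have "\<dots> = (k \<cdot>\<^sub>v z) $ i"
        using i by (simp add: ev[OF \<open>v i \<in> pverts G\<close>] z_def)
      finally show "(A *\<^sub>v z) $ i = (k \<cdot>\<^sub>v z) $ i" .
    qed (use A z in auto)
    ultimately show "\<exists>z\<in>carrier_vec n. z \<noteq> 0\<^sub>v n \<and> A *\<^sub>v z = k \<cdot>\<^sub>v z"
      using z by blast
  qed
  finally show ?thesis by (simp add: A_def)
qed

context pair_graph
begin

lemma ext_weight_sym: "ext_weight G u w = ext_weight G w u"
  using arcs_symmetric[of u w] arcs_symmetric[of w u] by (auto simp: ext_weight_def add.commute)

text \<open>\<open>Max\<close> is meaningful only on a finite nonempty set. Finiteness holds because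
  the characteristic polynomial is monic, hence nonzero; nonemptiness comes from the Rayleigh
  maximum \<open>l\<close>, which is an eigenvalue. Being one, \<open>l\<close> is at most the
  radius, and the Rayleigh bound passes from \<open>l\<close> to the radius.\<close>

lemma
  assumes ne: "pverts G \<noteq> {}" and bij: "bij_betw v {..<card (pverts G)} (pverts G)"
  shows ext_eigenvalue_ext_spectral_radius: "ext_eigenvalue G (ext_spectral_radius v G)"
    and ext_rayleigh_le: "(\<Sum>u\<in>pverts G. y u * (\<Sum>w\<in>pverts G. ext_weight G u w * y w))
      \<le> ext_spectral_radius v G * (\<Sum>u\<in>pverts G. (y u)\<^sup>2)"
    and ext_eigenvalue_le: "ext_eigenvalue G k \<Longrightarrow> k \<le> ext_spectral_radius v G"
proof -
  obtain l x where x: "\<exists>u\<in>pverts G. x u \<noteq> 0"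
    "\<And>u. u \<in> pverts G \<Longrightarrow> (\<Sum>w\<in>pverts G. ext_weight G u w * x w) = l * x u"
    and ray: "\<And>y. (\<Sum>u\<in>pverts G. y u * (\<Sum>w\<in>pverts G. ext_weight G u w * y w))
      \<le> l * (\<Sum>u\<in>pverts G. (y u)\<^sup>2)"
    by (rule symmetric_kernel_max_eigenvector[of "pverts G" "ext_weight G"])
      (use ne ext_weight_sym in auto)
  have l: "ext_eigenvalue G l" unfolding ext_eigenvalue_def using x by blast
  let ?E = "{k. eigenvalue (ext_adj_mat v G) k}"
  have A: "ext_adj_mat v G \<in> carrier_mat (card (pverts G)) (card (pverts G))"
    by (simp add: ext_adj_mat_def)
  have "char_poly (ext_adj_mat v G) \<noteq> 0"
    using degree_monic_char_poly[OF A] by auto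
  then have fin: "finite ?E"
    by (simp add: eigenvalue_root_char_poly[OF A] poly_roots_finite)
  have E: "?E = {k. ext_eigenvalue G k}"
    by (simp add: eigenvalue_ext_adj_mat_iff[OF bij])
  have "ext_spectral_radius v G \<in> ?E"
    unfolding ext_spectral_radius_def using fin l E by (intro Max_in) auto
  then show "ext_eigenvalue G (ext_spectral_radius v G)" using E by simp
  show le: "k \<le> ext_spectral_radius v G" if "ext_eigenvalue G k" for k
    unfolding ext_spectral_radius_def using fin that E by (intro Max_ge) auto
  have "l * (\<Sum>u\<in>pverts G. (y u)\<^sup>2) \<le> ext_spectral_radius v G * (\<Sum>u\<in>pverts G. (y u)\<^sup>2)"
    using le[OF l] by (intro mult_right_mono sum_nonneg) auto
  with ray[of y] show "(\<Sum>u\<in>pverts G. y u * (\<Sum>w\<in>pverts G. ext_weight G u w * y w))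
      \<le> ext_spectral_radius v G * (\<Sum>u\<in>pverts G. (y u)\<^sup>2)" by linarith
qed

end

text \<open>An isomorphism preserves degrees, therefore weights, and pulling eigenvectors back and
  forth along it identifies the two sets of eigenvalues.\<close>

lemma ext_spectral_radius_iso:
  assumes G: "pair_graph G" and H: "pair_graph H" and iso: "digraph_iso (with_proj G) (with_proj H)"
    and v: "bij_betw v {..<card (pverts G)} (pverts G)"
    and v': "bij_betw v' {..<card (pverts H)} (pverts H)"
  shows "ext_spectral_radius v G = ext_spectral_radius v' H"
proof -
  interpret G: pair_graph G by fact
  interpret H: pair_graph H by fact
  obtain f where f: "bij_betw f (pverts G) (pverts H)"
    and arc: "\<And>u w. u \<in> pverts G \<Longrightarrow> w \<in> pverts G \<Longrightarrow> (u, w) \<in> parcs G \<longleftrightarrow> (f u, f w) \<in> parcs H"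
    using iso digraph_iso_pair_iff[OF G.pair_wf_digraph_axioms H.pair_wf_digraph_axioms] by blast
  have inj: "inj_on f (pverts G)" and im: "f ` pverts G = pverts H"
    using f by (auto simp: bij_betw_def)
  have deg: "out_degree H (f u) = out_degree G u" if u: "u \<in> pverts G" for u
  proof -
    have "{w. (f u, w) \<in> parcs H} = f ` {w. (u, w) \<in> parcs G}"
    proof (intro equalityI subsetI)
      fix w' assume "w' \<in> {w. (f u, w) \<in> parcs H}"
      then have *: "(f u, w') \<in> parcs H" by simp
      then have "w' \<in> f ` pverts G" unfolding im by (rule H.in_arcsD2)
      with * show "w' \<in> f ` {w. (u, w) \<in> parcs G}" using arc[OF u] by auto
    qed (use arc[OF u] G.in_arcsD2 in auto)
    moreover have "inj_on f {w. (u, w) \<in> parcs G}"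
      using inj by (rule inj_on_subset) (auto dest: G.in_arcsD2)
    ultimately show ?thesis
      by (simp add: out_degree_eq_card_neighbours card_image)
  qed
  have wt: "ext_weight H (f u) (f w) = ext_weight G u w" if "u \<in> pverts G" "w \<in> pverts G" for u w
    using that by (simp add: ext_weight_def deg arc)
  have sum: "(\<Sum>w\<in>pverts H. ext_weight H (f u) w * x w) = (\<Sum>w\<in>pverts G. ext_weight G u w * x (f w))"
    if "u \<in> pverts G" for u x
    using that by (simp add: wt flip: sum.reindex_bij_betw[OF f])
  have "ext_eigenvalue G k \<longleftrightarrow> ext_eigenvalue H k" for k
  proof
    assume "ext_eigenvalue H k"
    then obtain x where "\<exists>u\<in>pverts H. x u \<noteq> 0"
      "\<forall>u\<in>pverts H. (\<Sum>w\<in>pverts H. ext_weight H u w * x w) = k * x u"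
      unfolding ext_eigenvalue_def by blast
    then have "\<exists>u\<in>pverts G. (x \<circ> f) u \<noteq> 0"
      "\<forall>u\<in>pverts G. (\<Sum>w\<in>pverts H. ext_weight H (f u) w * x w) = k * (x \<circ> f) u"
      by (auto simp flip: im)
    then show "ext_eigenvalue G k"
      unfolding ext_eigenvalue_def by (intro exI[of _ "x \<circ> f"]) (simp add: sum)
  next
    assume "ext_eigenvalue G k"
    then obtain x where x: "\<exists>u\<in>pverts G. x u \<noteq> 0"
      "\<forall>u\<in>pverts G. (\<Sum>w\<in>pverts G. ext_weight G u w * x w) = k * x u"
      unfolding ext_eigenvalue_def by blast
    define z where "z = x \<circ> the_inv_into (pverts G) f"
    have zf: "z (f u) = x u" if "u \<in> pverts G" for u
      using that inj by (simp add: z_def the_inv_into_f_f)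
    have "(\<Sum>w\<in>pverts H. ext_weight H (f u) w * z w) = k * z (f u)" if "u \<in> pverts G" for u
      using that x(2) by (simp add: sum zf)
    then have "\<forall>u\<in>pverts H. (\<Sum>w\<in>pverts H. ext_weight H u w * z w) = k * z u"
      by (simp flip: im)
    moreover have "\<exists>u\<in>pverts H. z u \<noteq> 0" using x(1) zf im by force
    ultimately show "ext_eigenvalue H k" unfolding ext_eigenvalue_def by blast
  qed
  then show ?thesis
    by (simp add: ext_spectral_radius_def eigenvalue_ext_adj_mat_iff[OF v] eigenvalue_ext_adj_mat_iff[OF v'])
qed

section \<open>Edge weights, arc counting, and graphs with a vertex of degree at least 3\<close>

lemma ext_weight_real_ge_1:
  fixes a b :: real
  assumes "a > 0" "b > 0"
  shows "(a / b + b / a) / 2 \<ge> 1"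
proof -
  have "0 \<le> (a - b)\<^sup>2" by simp
  then show ?thesis using assms by (simp add: field_simps power2_eq_square)
qed

text \<open>Meant for a pendant edge whose other end has degree \<open>a\<close>. After clearing
  denominators the claim is 2 a^2 - 5 a + 2 >= 0, which factors as (2 a - 1) (a - 2) >= 0; equality
  holds at \<open>a = 2\<close>.\<close>

lemma ext_weight_real_leaf_ge:
  fixes a :: real
  assumes "a \<ge> 2"
  shows "(1 / a + a / 1) / 2 \<ge> 5 / 4"
proof -
  have "0 \<le> (2 * a - 1) * (a - 2)" using assms by simp
  then show ?thesis using assms by (simp add: field_simps power2_eq_square)
qed

context pair_graph
begin

lemma finite_neighbours: "finite {w. (u, w) \<in> parcs G}"
  by (rule finite_subset[of _ "pverts G"]) (auto dest: in_arcsD2)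

lemma sum_out_degree_eq_card_arcs: "(\<Sum>u\<in>pverts G. out_degree G u) = card (parcs G)"
proof -
  have "parcs G = Sigma (pverts G) (\<lambda>u. {w. (u, w) \<in> parcs G})"
    by (auto dest: in_arcsD1)
  then have "card (parcs G) = card (Sigma (pverts G) (\<lambda>u. {w. (u, w) \<in> parcs G}))" by simp
  then show ?thesis
    by (simp add: card_SigmaI finite_neighbours out_degree_eq_card_neighbours)
qed

text \<open>If no arc left \<open>S\<close>, every vertex reachable from \<open>S\<close> would lie
  in \<open>S\<close>. Connectedness is defined through the symmetric closure, which has the same
  reachability here because the arcs are already symmetric.\<close>

lemma connected_cut_arc:
  assumes conn: "Digraph_Component.connected G" and S: "S \<subset> pverts G" "S \<noteq> {}"
  obtains u w where "u \<in> S" "w \<in> pverts G - S" "(u, w) \<in> parcs G"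
proof -
  have "\<exists>u\<in>S. \<exists>w\<in>pverts G - S. (u, w) \<in> parcs G"
  proof (rule ccontr)
    assume "\<not> ?thesis"
    then have closed: "w \<in> S" if "u \<in> S" "(u, w) \<in> parcs G" for u w
      using that in_arcsD2[of u w] by blast
    obtain u w where uw: "u \<in> S" "w \<in> pverts G" "w \<notin> S" using S by auto
    have "u \<in> pverts G" using uw S by auto
    then have "u \<rightarrow>\<^sup>*\<^bsub>mk_symmetric G\<^esub> w"
      using conn uw by (auto simp: connected_def strongly_connected_def)
    then have "u \<rightarrow>\<^sup>*\<^bsub>with_proj G\<^esub> w"
      using reachable_mk_symmetric_eq[OF sym_arcs] by simp
    then have "(u, w) \<in> (parcs G)\<^sup>*"
      using reachable_rtranclI by fastforce
    then have "w \<in> S"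
      by (induction rule: rtrancl_induct) (use uw closed in auto)
    with uw show False by simp
  qed
  with that show thesis by blast
qed

text \<open>A vertex set is grown one vertex at a time along cut arcs. Each new vertex brings two
  arcs, one in each direction, so this is the spanning tree bound counted in arcs.\<close>

lemma connected_card_arcs_ge:
  assumes conn: "Digraph_Component.connected G" and ne: "pverts G \<noteq> {}"
  shows "2 * (card (pverts G) - 1) \<le> card (parcs G)"
proof -
  have finA: "finite (parcs G)" by simp
  have "\<exists>S \<subseteq> pverts G. card S = Suc k \<and> 2 * k \<le> card (parcs G \<inter> S \<times> S)"
    if "Suc k \<le> card (pverts G)" for k
    using that
  proof (induction k)
    case 0
    obtain r where "r \<in> pverts G" using ne by auto
    then show ?case by (intro exI[of _ "{r}"]) auto
  next
    case (Suc k)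
    then obtain S where S: "S \<subseteq> pverts G" "card S = Suc k" "2 * k \<le> card (parcs G \<inter> S \<times> S)"
      by auto
    have finS: "finite S" using S(1) by (rule finite_subset) simp
    have "S \<subset> pverts G" "S \<noteq> {}" using S Suc.prems by auto
    then obtain u w where uw: "u \<in> S" "w \<in> pverts G - S" "(u, w) \<in> parcs G"
      using connected_cut_arc[OF conn] by blast
    have "(w, u) \<in> parcs G" using uw(3) by (rule arcs_symmetric)
    let ?T = "insert w S"
    have "{(u, w), (w, u)} \<union> (parcs G \<inter> S \<times> S) \<subseteq> parcs G \<inter> ?T \<times> ?T"
      using uw \<open>(w, u) \<in> parcs G\<close> by auto
    then have "card ({(u, w), (w, u)} \<union> (parcs G \<inter> S \<times> S)) \<le> card (parcs G \<inter> ?T \<times> ?T)"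
      using finA by (intro card_mono) auto
    moreover have "card ({(u, w), (w, u)} \<union> (parcs G \<inter> S \<times> S)) = 2 + card (parcs G \<inter> S \<times> S)"
    proof -
      have "u \<noteq> w" using uw by auto
      then have "card {(u, w), (w, u)} = 2" by simp
      moreover have "{(u, w), (w, u)} \<inter> (parcs G \<inter> S \<times> S) = {}" using uw by auto
      ultimately show ?thesis using finA by (subst card_Un_disjoint) auto
    qed
    ultimately show ?case
      using S uw finS by (intro exI[of _ ?T]) auto
  qed
  from this[of "card (pverts G) - 1"] obtain S where
    "2 * (card (pverts G) - 1) \<le> card (parcs G \<inter> S \<times> S)"
    using ne by (auto simp: card_gt_0_iff Suc_leI)
  also have "\<dots> \<le> card (parcs G)" using finA by (intro card_mono) auto
  finally show ?thesis .
qed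

lemma connected_out_degree_pos:
  assumes "Digraph_Component.connected G" "card (pverts G) \<ge> 2" "u \<in> pverts G"
  shows "out_degree G u > 0"
proof -
  have "{u} \<subset> pverts G" using assms(2,3) by (metis card.empty card.insert empty_iff empty_subsetI
      finite.emptyI insert_subset not_less_eq_eq numeral_2_eq_2 order_refl psubsetI One_nat_def)
  then obtain w where "(u, w) \<in> parcs G"
    using connected_cut_arc[OF assms(1), of "{u}"] by blast
  then show ?thesis
    using finite_neighbours[of u] by (auto simp: out_degree_eq_card_neighbours card_gt_0_iff)
qed

text \<open>Two adjacent leaves have no further neighbours, so no arc leaves the pair, although a
  third vertex exists.\<close>

lemma connected_no_adjacent_leaves:
  assumes conn: "Digraph_Component.connected G" and card: "card (pverts G) \<ge> 3"
    and uw: "(u, w) \<in> parcs G" "out_degree G u = 1"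
  shows "out_degree G w \<noteq> 1"
proof
  assume w: "out_degree G w = 1"
  have wu: "(w, u) \<in> parcs G" using uw(1) by (rule arcs_symmetric)
  have leaf: "c = b" if "out_degree G a = 1" "(a, b) \<in> parcs G" "(a, c) \<in> parcs G" for a b c
  proof -
    obtain z where "{w. (a, w) \<in> parcs G} = {z}"
      using \<open>out_degree G a = 1\<close> unfolding out_degree_eq_card_neighbours by (rule card_1_singletonE)
    with that show ?thesis by (metis mem_Collect_eq singletonD)
  qed
  have "card {u, w} \<le> 2" by (simp add: card_insert_if)
  then have "{u, w} \<noteq> pverts G" using card by auto
  then have "{u, w} \<subset> pverts G" using uw wu by (auto dest: in_arcsD1)
  then obtain a b where "a \<in> {u, w}" "b \<in> pverts G - {u, w}" "(a, b) \<in> parcs G"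
    using connected_cut_arc[OF conn] by blast
  then show False using leaf[of u w b] leaf[of w u b] uw w wu by auto
qed

text \<open>The value 5/8 on leaves is half the smallest weight 5/4 of a pendant edge.\<close>

lemma ext_spectral_radius_gt_2:
  assumes conn: "Digraph_Component.connected G" and card: "card (pverts G) \<ge> 3"
    and bij: "bij_betw v {..<card (pverts G)} (pverts G)"
    and r: "r \<in> pverts G" "out_degree G r \<ge> 3"
  shows "ext_spectral_radius v G > 2"
proof -
  define V where "V = pverts G"
  define d where "d u = out_degree G u" for u
  define l where "l u = (if d u = 1 then 1 else 0 :: real)" for u
  define e where "e u w = (if (u, w) \<in> parcs G then 1 else 0 :: real)" for u w
  define y where "y u = 1 - 3 / 8 * l u" for u
  define n where "n = real (card V)"
  define D where "D = real (card (parcs G))"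
  define L where "L = (\<Sum>u\<in>V. l u)"
  have fin: "finite V" by (simp add: V_def)
  have dpos: "d u \<ge> 1" if "u \<in> V" for u
    using connected_out_degree_pos[OF conn, of u] card that by (simp add: V_def d_def Suc_leI)
  \<comment> \<open>On a pendant edge the right side is at least 5/8 * 5/4 = 25/32 = 1 - 7/32, and
    on other edges at least 1. Writing the bound linearly in the leaf indicators lets the double sum
    be evaluated; both indicators are never 1 on one edge.\<close>
  have arc: "e u w * (1 - 7 / 32 * l u - 7 / 32 * l w) \<le> y u * (ext_weight G u w * y w)"
    if uw: "u \<in> V" "w \<in> V" for u w
  proof (cases "(u, w) \<in> parcs G")
    case True
    have wt: "ext_weight G u w = (real (d u) / real (d w) + real (d w) / real (d u)) / 2"
      using True by (simp add: ext_weight_def d_def)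
    consider "d u = 1" "d w \<ge> 2" | "d u \<ge> 2" "d w = 1" | "d u \<ge> 2" "d w \<ge> 2"
      using connected_no_adjacent_leaves[OF conn card True] dpos[OF uw(1)] dpos[OF uw(2)]
      unfolding d_def by linarith
    then show ?thesis
    proof cases
      case 1
      then have "ext_weight G u w \<ge> 5 / 4"
        using ext_weight_real_leaf_ge[of "real (d w)"] by (simp add: wt)
      then show ?thesis using 1 True by (simp add: l_def y_def e_def)
    next
      case 2
      then have "ext_weight G u w \<ge> 5 / 4"
        using ext_weight_real_leaf_ge[of "real (d u)"] by (simp add: wt)
      then show ?thesis using 2 True by (simp add: l_def y_def e_def)
    next
      case 3
      then have "ext_weight G u w \<ge> 1"
        unfolding wt by (intro ext_weight_real_ge_1) auto
      then show ?thesis using 3 True by (simp add: l_def y_def e_def)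
    qed
  qed (simp add: e_def ext_weight_def)
  have deg: "(\<Sum>w\<in>V. e u w) = real (d u)" for u
  proof -
    have "{w \<in> V. (u, w) \<in> parcs G} = {w. (u, w) \<in> parcs G}"
      by (auto simp: V_def dest: in_arcsD2)
    then show ?thesis
      using fin by (simp add: e_def d_def out_degree_eq_card_neighbours sum.If_cases Int_def)
  qed
  have D: "(\<Sum>u\<in>V. real (d u)) = D"
    using sum_out_degree_eq_card_arcs by (simp add: D_def d_def V_def flip: of_nat_sum)
  \<comment> \<open>A leaf has exactly one arc in each direction, so each of the two indicator
    double sums counts every leaf once.\<close>
  have dl: "real (d u) * l u = l u" for u by (simp add: l_def)
  have s1: "(\<Sum>u\<in>V. \<Sum>w\<in>V. e u w * l u) = L"
    by (simp add: deg dl L_def flip: sum_distrib_right)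
  have "(\<Sum>u\<in>V. \<Sum>w\<in>V. e u w * l w) = (\<Sum>w\<in>V. \<Sum>u\<in>V. e u w * l w)" by (rule sum.swap)
  also have "\<dots> = (\<Sum>w\<in>V. \<Sum>u\<in>V. e w u * l w)"
    using arcs_symmetric by (intro sum.cong refl) (auto simp: e_def)
  finally have s2: "(\<Sum>u\<in>V. \<Sum>w\<in>V. e u w * l w) = L" using s1 by simp
  have "D - 7 / 16 * L = (\<Sum>u\<in>V. \<Sum>w\<in>V. e u w) - 7 / 32 * (\<Sum>u\<in>V. \<Sum>w\<in>V. e u w * l u)
      - 7 / 32 * (\<Sum>u\<in>V. \<Sum>w\<in>V. e u w * l w)"
    unfolding s1 s2 deg D by simp
  also have "\<dots> = (\<Sum>u\<in>V. \<Sum>w\<in>V. e u w * (1 - 7 / 32 * l u - 7 / 32 * l w))"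
    unfolding sum_distrib_left sum_subtractf[symmetric]
    by (intro sum.cong refl) (simp add: algebra_simps)
  also have "\<dots> \<le> (\<Sum>u\<in>V. \<Sum>w\<in>V. y u * (ext_weight G u w * y w))"
    by (intro sum_mono arc)
  also have "\<dots> = (\<Sum>u\<in>V. y u * (\<Sum>w\<in>V. ext_weight G u w * y w))"
    by (simp add: sum_distrib_left)
  also have "\<dots> \<le> ext_spectral_radius v G * (\<Sum>u\<in>V. (y u)\<^sup>2)"
    unfolding V_def using r by (intro ext_rayleigh_le bij) auto
  finally have Q: "D - 7 / 16 * L \<le> ext_spectral_radius v G * (\<Sum>u\<in>V. (y u)\<^sup>2)" .
  \<comment> \<open>At a leaf this is (5/8)^2 = 25/64.\<close>
  have "(y u)\<^sup>2 = 1 - 39 / 64 * l u" for u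
    by (simp add: y_def l_def power2_eq_square)
  then have N: "(\<Sum>u\<in>V. (y u)\<^sup>2) = n - 39 / 64 * L"
    by (simp add: sum_subtractf n_def L_def sum_distrib_left)
  \<comment> \<open>The summand \<open>d u - 2 + l u\<close> is 0 at a leaf and nonnegative
    elsewhere, so the vertex \<open>r\<close> alone makes the total at least 1. The total is
    \<open>D - 2 * n + L\<close>.\<close>
  have "1 \<le> real (d r) - 2 + l r" using r by (simp add: d_def l_def)
  also have "\<dots> \<le> (\<Sum>u\<in>V. real (d u) - 2 + l u)"
  proof (intro member_le_sum fin)
    show "0 \<le> real (d u) - 2 + l u" if "u \<in> V - {r}" for u
      using dpos[of u] that by (auto simp: l_def)
  qed (use r in \<open>simp add: V_def\<close>)
  also have "\<dots> = D - 2 * n + L"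
    by (simp add: sum.distrib sum_subtractf D L_def n_def)
  finally have L: "L \<ge> 2 * n - D + 1" by simp
  have "D \<ge> 2 * n - 2"
  proof -
    have "2 * (card V - 1) \<le> card (parcs G)"
      unfolding V_def using r by (intro connected_card_arcs_ge conn) auto
    then show ?thesis unfolding D_def n_def by linarith
  qed
  \<comment> \<open>The difference of the two sides is at least
    \<open>D - 2 * n + 25 / 32 * L\<close>, and the bounds on \<open>L\<close> and \<open>D\<close>
    make this at least 25/32 - 14/32 = 11/32.\<close>
  with L N Q have "2 * (\<Sum>u\<in>V. (y u)\<^sup>2) < ext_spectral_radius v G * (\<Sum>u\<in>V. (y u)\<^sup>2)"
    by linarith
  moreover have "(\<Sum>u\<in>V. (y u)\<^sup>2) \<ge> 0" by (simp add: sum_nonneg)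
  ultimately show ?thesis
    by (meson mult_right_less_imp_less)
qed

section \<open>Regular graphs\<close>

text \<open>All edge weights are 1. The constant vector is an eigenvector for \<open>k\<close> and,
  being positive, also serves as the test vector that bounds every eigenvalue by
  \<open>k\<close>.\<close>

lemma ext_spectral_radius_regular:
  assumes ne: "pverts G \<noteq> {}" and bij: "bij_betw v {..<card (pverts G)} (pverts G)"
    and reg: "\<And>u. u \<in> pverts G \<Longrightarrow> out_degree G u = k" and k: "k > 0"
  shows "ext_spectral_radius v G = real k"
proof -
  have row: "(\<Sum>w\<in>pverts G. ext_weight G u w * 1) = real k" if "u \<in> pverts G" for u
  proof -
    have "{w \<in> pverts G. (u, w) \<in> parcs G} = {w. (u, w) \<in> parcs G}"
      by (auto dest: in_arcsD2)
    moreover have "(\<Sum>w\<in>pverts G. ext_weight G u w * 1)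
        = (\<Sum>w\<in>pverts G. if (u, w) \<in> parcs G then 1 else 0)"
      using that k by (intro sum.cong refl) (simp add: ext_weight_def reg)
    ultimately show ?thesis
      using reg[OF that] by (simp add: out_degree_eq_card_neighbours sum.If_cases Int_def)
  qed
  have "ext_eigenvalue G (real k)"
    unfolding ext_eigenvalue_def using ne row by (intro exI[of _ "\<lambda>_. 1"]) auto
  then have ge: "real k \<le> ext_spectral_radius v G"
    by (rule ext_eigenvalue_le[OF ne bij])
  obtain x where x: "\<exists>u\<in>pverts G. x u \<noteq> 0"
    "\<And>u. u \<in> pverts G \<Longrightarrow> (\<Sum>w\<in>pverts G. ext_weight G u w * x w) = ext_spectral_radius v G * x u"
    using ext_eigenvalue_ext_spectral_radius[OF ne bij] unfolding ext_eigenvalue_def by blast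
  obtain u where "u \<in> pverts G"
    "ext_spectral_radius v G * 1 \<le> (\<Sum>w\<in>pverts G. ext_weight G u w * 1)"
    by (rule nonneg_kernel_eigenvalue_bound[of "pverts G" "ext_weight G" "\<lambda>_. 1", OF _ _ _ x])
      (auto simp: ext_weight_nonneg)
  with row ge show ?thesis by simp
qed

end

section \<open>Connected graphs of maximal degree at most 2\<close>

context pair_graph
begin

lemma out_degree_le_2_third_neighbour:
  assumes "out_degree G u \<le> 2" "(u, a) \<in> parcs G" "(u, b) \<in> parcs G" "a \<noteq> b" "(u, c) \<in> parcs G"
  shows "c = a \<or> c = b"
proof (rule ccontr)
  assume "\<not> ?thesis"
  then have "card {a, b, c} = 3" using \<open>a \<noteq> b\<close> by auto
  moreover have "card {a, b, c} \<le> card {w. (u, w) \<in> parcs G}"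
    using assms by (intro card_mono finite_neighbours) auto
  ultimately show False using assms(1) by (simp add: out_degree_eq_card_neighbours)
qed

text \<open>The predecessor and successor on the path already exhaust the degree bound.\<close>

lemma path_interior_neighbours:
  assumes deg: "\<And>u. u \<in> pverts G \<Longrightarrow> out_degree G u \<le> 2"
    and inj: "inj_on p {..<k}" and steps: "\<And>i. Suc i < k \<Longrightarrow> (p i, p (Suc i)) \<in> parcs G"
    and i: "0 < i" "Suc i < k" and c: "(p i, c) \<in> parcs G"
  shows "c = p (i - 1) \<or> c = p (Suc i)"
proof (rule out_degree_le_2_third_neighbour)
  show "out_degree G (p i) \<le> 2" using c by (intro deg) (rule in_arcsD1)
  show "(p i, p (i - 1)) \<in> parcs G"
    using steps[of "i - 1"] i by (simp add: arcs_symmetric)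
  show "p (i - 1) \<noteq> p (Suc i)"
    using inj_on_eq_iff[OF inj, of "i - 1" "Suc i"] i by simp
qed (use steps i c in auto)

text \<open>A path missing some vertex has an arc leaving it. That arc cannot start at an interior
  vertex, whose neighbours are all on the path, so the path can be prolonged at one of its
  ends.\<close>

lemma connected_hamiltonian_path:
  assumes conn: "Digraph_Component.connected G"
    and deg: "\<And>u. u \<in> pverts G \<Longrightarrow> out_degree G u \<le> 2"
    and k: "0 < k" "k \<le> card (pverts G)"
  shows "\<exists>p. inj_on p {..<k} \<and> p ` {..<k} \<subseteq> pverts G \<and> (\<forall>i. Suc i < k \<longrightarrow> (p i, p (Suc i)) \<in> parcs G)"
  using k
proof (induction k rule: nat_induct_non_zero)
  case 1
  then obtain r where "r \<in> pverts G" by fastforce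
  then show ?case by (intro exI[of _ "\<lambda>_. r"]) (auto simp: inj_on_def)
next
  case (Suc k)
  then obtain p where p: "inj_on p {..<k}" "p ` {..<k} \<subseteq> pverts G"
    "\<And>i. Suc i < k \<Longrightarrow> (p i, p (Suc i)) \<in> parcs G"
    by auto
  have "card (p ` {..<k}) = k" using p(1) by (simp add: card_image)
  then have "p ` {..<k} \<noteq> pverts G" using Suc.prems by auto
  with p(2) have "p ` {..<k} \<subset> pverts G" by blast
  moreover have "p ` {..<k} \<noteq> {}" using Suc.hyps by auto
  ultimately obtain u w where "u \<in> p ` {..<k}" "w \<in> pverts G - p ` {..<k}" "(u, w) \<in> parcs G"
    using connected_cut_arc[OF conn] by blast
  then obtain i where i: "i < k" "(p i, w) \<in> parcs G" and w: "w \<in> pverts G" "w \<notin> p ` {..<k}"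
    by auto
  have append: ?case
    if q: "inj_on q {..<k}" "q ` {..<k} = p ` {..<k}"
      "\<And>i. Suc i < k \<Longrightarrow> (q i, q (Suc i)) \<in> parcs G" "(q (k - 1), w) \<in> parcs G" for q
  proof (intro exI[of _ "q(k := w)"] conjI allI impI)
    have "w \<notin> q ` {..<k}" using w q by simp
    then show "inj_on (q(k := w)) {..<Suc k}"
      using q(1) by (simp add: lessThan_Suc inj_on_fun_updI)
    show "(q(k := w)) ` {..<Suc k} \<subseteq> pverts G"
      using q(2) p(2) w(1) by (auto simp: lessThan_Suc)
    show "((q(k := w)) j, (q(k := w)) (Suc j)) \<in> parcs G" if "Suc j < Suc k" for j
      using that q(3)[of j] q(4) by (cases "Suc j = k") auto
  qed
  consider "i = k - 1" | "i = 0" | "0 < i" "Suc i < k" using i by linarith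
  then show ?case
  proof cases
    case 1
    with p i show ?thesis by (intro append[of p]) auto
  next
    case 2
    \<comment> \<open>If the new vertex is attached to the start, the path is reversed so that the
      vertex can be appended at the end.\<close>
    define q where "q j = p (k - 1 - j)" for j
    have "bij_betw (\<lambda>j. k - 1 - j) {..<k} {..<k}"
      by (rule bij_betw_byWitness[of _ "\<lambda>j. k - 1 - j"]) auto
    then have rev: "inj_on (\<lambda>j. k - 1 - j) {..<k}" "(\<lambda>j. k - 1 - j) ` {..<k} = {..<k}"
      by (auto simp: bij_betw_def)
    have q: "q = p \<circ> (\<lambda>j. k - 1 - j)" by (auto simp: q_def)
    show ?thesis
    proof (rule append)
      show "inj_on q {..<k}" unfolding q by (rule comp_inj_on[OF rev(1)]) (simp only: rev(2) p(1))
      show "q ` {..<k} = p ` {..<k}" unfolding q image_comp[symmetric] rev(2) ..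
      show "(q j, q (Suc j)) \<in> parcs G" if "Suc j < k" for j
      proof -
        have "Suc (k - 1 - Suc j) = k - 1 - j" using that by simp
        then show ?thesis
          using p(3)[of "k - 1 - Suc j"] that by (simp add: q_def arcs_symmetric)
      qed
      show "(q (k - 1), w) \<in> parcs G" using i 2 by (simp add: q_def)
    qed
  next
    case 3
    then have "w = p (i - 1) \<or> w = p (Suc i)"
      using path_interior_neighbours[OF deg p(1,3)] i(2) by blast
    with w(2) 3 have False by auto
    then show ?thesis ..
  qed
qed

text \<open>Along a Hamiltonian path interior vertices have no further neighbours, so the only other
  possible edge joins the two ends. Its presence gives the cycle, its absence the path.\<close>

lemma connected_out_degree_le_2_iso:
  assumes conn: "Digraph_Component.connected G"
    and deg: "\<And>u. u \<in> pverts G \<Longrightarrow> out_degree G u \<le> 2"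
    and n: "card (pverts G) = n" "n \<ge> 3"
  shows "digraph_iso G (path_graph n) \<or> digraph_iso G (cycle_graph n)"
proof -
  obtain p where p: "inj_on p {..<n}" "p ` {..<n} \<subseteq> pverts G"
    "\<And>i. Suc i < n \<Longrightarrow> (p i, p (Suc i)) \<in> parcs G"
    using connected_hamiltonian_path[OF conn deg, of n] n by auto
  have im: "p ` {..<n} = pverts G"
    using p(1,2) n by (intro card_subset_eq) (auto simp: card_image)
  define f where "f = the_inv_into {..<n} p"
  have fp: "f (p i) = i" if "i < n" for i
    using that p(1) by (simp add: f_def the_inv_into_f_f)
  have bf: "bij_betw f (pverts G) {..<n}"
    unfolding f_def using p(1) im by (intro bij_betw_the_inv_into) (simp add: bij_betw_def)
  have interior: "j = i - 1 \<or> j = Suc i"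
    if "0 < i" "Suc i < n" "j < n" "(p i, p j) \<in> parcs G" for i j
  proof -
    have "p j = p (i - 1) \<or> p j = p (Suc i)"
      using path_interior_neighbours[OF deg p(1,3) that(1,2,4)] .
    then show ?thesis
      using inj_onD[OF p(1), of j "i - 1"] inj_onD[OF p(1), of j "Suc i"] that by auto
  qed
  have arcs: "j = Suc i \<or> i = Suc j \<or> i = 0 \<and> j = n - 1 \<or> i = n - 1 \<and> j = 0"
    if ij: "i < n" "j < n" "(p i, p j) \<in> parcs G" for i j
  proof -
    have "i \<noteq> j" using no_loops[OF ij(3)] by auto
    moreover have "(p j, p i) \<in> parcs G" using ij(3) by (rule arcs_symmetric)
    ultimately show ?thesis
      using interior[of i j] interior[of j i] ij by (cases "0 < i \<and> Suc i < n"; cases "0 < j \<and> Suc j < n") auto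
  qed
  have steps: "(p i, p j) \<in> parcs G" if "i < n" "j < n" "j = Suc i \<or> i = Suc j" for i j
    using that p(3)[of i] p(3)[of j] arcs_symmetric[of "p j" "p i"] by auto
  have iso: "digraph_iso G H"
    if "pair_graph H" "pverts H = {..<n}"
      and H: "\<And>i j. i < n \<Longrightarrow> j < n \<Longrightarrow> (p i, p j) \<in> parcs G \<longleftrightarrow> (i, j) \<in> parcs H" for H
  proof -
    interpret H: pair_graph H by fact
    have "(u, w) \<in> parcs G \<longleftrightarrow> (f u, f w) \<in> parcs H" if "u \<in> pverts G" "w \<in> pverts G" for u w
      using that H unfolding im[symmetric] by (auto simp: fp)
    then show ?thesis
      using bf \<open>pverts H = _\<close>
      unfolding digraph_iso_pair_iff[OF pair_wf_digraph_axioms H.pair_wf_digraph_axioms]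
      by auto
  qed
  show ?thesis
  proof (cases "(p 0, p (n - 1)) \<in> parcs G")
    case True
    then have True': "(p (n - 1), p 0) \<in> parcs G" by (rule arcs_symmetric)
    have "(p i, p j) \<in> parcs G \<longleftrightarrow> j = Suc i mod n \<or> i = Suc j mod n" if ij: "i < n" "j < n" for i j
    proof -
      have "j = Suc i mod n \<longleftrightarrow> j = Suc i \<or> i = n - 1 \<and> j = 0"
        using ij by (cases "Suc i = n") auto
      moreover have "i = Suc j mod n \<longleftrightarrow> i = Suc j \<or> j = n - 1 \<and> i = 0"
        using ij by (cases "Suc j = n") auto
      ultimately show ?thesis using arcs[OF ij] steps[OF ij] True True' by auto
    qed
    then have "digraph_iso G (cycle_graph n)"
      using n by (intro iso pair_graph_cycle_graph) (auto simp: cycle_graph_def)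
    then show ?thesis ..
  next
    case False
    then have False': "(p (n - 1), p 0) \<notin> parcs G" using arcs_symmetric[of "p (n - 1)" "p 0"] by auto
    have "(p i, p j) \<in> parcs G \<longleftrightarrow> j = Suc i \<or> i = Suc j" if ij: "i < n" "j < n" for i j
      using arcs[OF ij] steps[OF ij] False False' by auto
    then have "digraph_iso G (path_graph n)"
      by (intro iso pair_graph_path_graph) (auto simp: path_graph_def)
    then show ?thesis ..
  qed
qed

end

section \<open>The radii of the cycle and the path\<close>

lemma ext_spectral_radius_cycle_graph:
  assumes "n \<ge> 3"
  shows "ext_spectral_radius id (cycle_graph n) = 2"
proof -
  interpret C: pair_graph "cycle_graph n" using assms by (rule pair_graph_cycle_graph)
  have V: "pverts (cycle_graph n) = {..<n}" by (simp add: cycle_graph_def)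
  have deg: "out_degree (cycle_graph n) i = 2" if "i \<in> pverts (cycle_graph n)" for i
  proof -
    have i: "i < n" using that V by simp
    define a where "a = (if Suc i = n then 0 else Suc i)"
    define b where "b = (if i = 0 then n - 1 else i - 1)"
    have "j = Suc i mod n \<longleftrightarrow> j = a" for j
      using i by (cases "Suc i = n") (auto simp: a_def)
    moreover have "i = Suc j mod n \<longleftrightarrow> j = b" if "j < n" for j
      using i that by (cases "Suc j = n") (auto simp: b_def)
    moreover have "a < n" "b < n" using i by (auto simp: a_def b_def)
    ultimately have "{j. (i, j) \<in> parcs (cycle_graph n)} = {a, b}"
      using i by (auto simp: cycle_graph_def)
    \<comment> \<open>The cyclic successor and predecessor are different because
      \<open>n \<ge> 3\<close>; this is what makes the degree 2.\<close>
    moreover have "a \<noteq> b" using i assms by (auto simp: a_def b_def)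
    ultimately show ?thesis by (simp add: out_degree_eq_card_neighbours)
  qed
  have "ext_spectral_radius id (cycle_graph n) = real 2"
    by (rule C.ext_spectral_radius_regular) (use deg V assms in \<open>auto simp: bij_betw_def lessThan_empty_iff\<close>)
  then show ?thesis by simp
qed

text \<open>The concave profile of \<open>y\<close> gives \<open>A y = 2 y - 2\<close> away from the ends, and the lower end value
  \<open>15 n / 4\<close> absorbs the weight 5/4 of the pendant edges.\<close>

lemma ext_spectral_radius_path_graph_lt_2:
  assumes n: "n \<ge> 5"
  shows "ext_spectral_radius id (path_graph n) < 2"
proof -
  interpret P: pair_graph "path_graph n" by (rule pair_graph_path_graph)
  have V: "pverts (path_graph n) = {..<n}" by (simp add: path_graph_def)
  have N0: "{j. (0, j) \<in> parcs (path_graph n)} = {1}"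
    and N1: "{j. (n - 1, j) \<in> parcs (path_graph n)} = {n - 2}"
    using n by (auto simp: path_graph_def)
  have Ni: "{j. (i, j) \<in> parcs (path_graph n)} = {i - 1, Suc i}" if "0 < i" "i < n - 1" for i
    using that by (auto simp: path_graph_def)
  have d0: "out_degree (path_graph n) 0 = 1" and d1: "out_degree (path_graph n) (n - 1) = 1"
    unfolding out_degree_eq_card_neighbours N0 N1 by simp_all
  have di: "out_degree (path_graph n) i = 2" if "0 < i" "i < n - 1" for i
    unfolding out_degree_eq_card_neighbours Ni[OF that] using that by simp
  have row: "(\<Sum>j<n. ext_weight (path_graph n) i j * y j)
      = (\<Sum>j\<in>{j. (i, j) \<in> parcs (path_graph n)}. ext_weight (path_graph n) i j * y j)" for i y
    by (intro sum.mono_neutral_right) (auto simp: path_graph_def ext_weight_def)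
  have arc: "ext_weight (path_graph n) i j
      = (real (out_degree (path_graph n) i) / real (out_degree (path_graph n) j)
        + real (out_degree (path_graph n) j) / real (out_degree (path_graph n) i)) / 2"
    if "j \<in> {j. (i, j) \<in> parcs (path_graph n)}" for i j
    using that by (simp add: ext_weight_def)
  \<comment> \<open>The slope of the quadratic near the ends is of order \<open>n\<close>, so the
    base level must be too. With base level c n, the inequality at an end permits the end value 5/8
    (c + 1) n; the inequality next to it then holds as soon as 25/32 (c + 1) <= c. The choice c = 5
    satisfies this and gives 15/4 n.\<close>
  define y where "y i = (if i = 0 \<or> i = n - 1 then 15 / 4 * real n
      else 5 * real n + real i * (real n - 1 - real i))" for i
  have ypos: "y i > 0" if "i < n" for i
  proof -
    have "real i \<le> real n - 1" using that by linarith
    then have "0 \<le> real i * (real n - 1 - real i)" by simp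
    then show ?thesis using n by (auto simp: y_def)
  qed
  have y1: "y 1 = 6 * real n - 2" and y2: "y 2 = 7 * real n - 6"
    using n by (auto simp: y_def)
  have y1': "y (n - 2) = 6 * real n - 2" and y2': "y (n - 3) = 7 * real n - 6"
    using n by (auto simp: y_def of_nat_diff algebra_simps)
  have yends: "y 0 = 15 / 4 * real n" "y (n - 1) = 15 / 4 * real n"
    by (simp_all add: y_def)
  have small: "(\<Sum>j<n. ext_weight (path_graph n) i j * y j) < 2 * y i" if i: "i < n" for i
  proof -
    \<comment> \<open>The ends and their neighbours are treated separately: only in their rows does
      a pendant edge or the lowered end value occur.\<close>
    consider "i = 0" | "i = n - 1" | "i = 1" | "i = n - 2" | "2 \<le> i" "i < n - 2" using i by linarith
    then show ?thesis
    proof cases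
      case 1
      have w: "ext_weight (path_graph n) 0 1 = 5 / 4"
        using n N0 by (subst arc) (auto simp: d0 di)
      show ?thesis using n unfolding 1 row N0 by (simp add: w y1 yends del: One_nat_def)
    next
      case 2
      have w: "ext_weight (path_graph n) (n - 1) (n - 2) = 5 / 4"
        using n N1 by (subst arc) (auto simp: d1[unfolded One_nat_def] di)
      show ?thesis using n unfolding 2 row N1 by (simp add: w y1' yends del: One_nat_def)
    next
      case 3
      have N: "{j. (1, j) \<in> parcs (path_graph n)} = {0, 2}"
        using Ni[of 1] n by (simp add: numeral_2_eq_2)
      have w: "ext_weight (path_graph n) 1 0 = 5 / 4" "ext_weight (path_graph n) 1 2 = 1"
        using n N by (subst arc; auto simp: d0 di)+
      show ?thesis using n unfolding 3 row N by (simp add: w y1 y2 yends del: One_nat_def)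
    next
      case 4
      have N: "{j. (n - 2, j) \<in> parcs (path_graph n)} = {n - 3, n - 1}"
      proof -
        have "n - 2 - 1 = n - 3" "Suc (n - 2) = n - 1" using n by simp_all
        then show ?thesis using Ni[of "n - 2"] n by simp
      qed
      have w: "ext_weight (path_graph n) (n - 2) (n - 1) = 5 / 4"
        "ext_weight (path_graph n) (n - 2) (n - 3) = 1"
        using n N by (subst arc; auto simp: d1[unfolded One_nat_def] di)+
      have "n - 3 \<noteq> n - 1" using n by simp
      then show ?thesis using n unfolding 4 row N by (simp add: w y1' y2' yends del: One_nat_def)
    next
      case 5
      have N: "{j. (i, j) \<in> parcs (path_graph n)} = {i - 1, Suc i}"
        using Ni[of i] 5 by simp
      have w: "ext_weight (path_graph n) i (i - 1) = 1" "ext_weight (path_graph n) i (Suc i) = 1"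
        using 5 N by (subst arc; auto simp: di)+
      have "y (i - 1) + y (Suc i) = 2 * y i - 2"
      proof -
        have "i - 1 \<noteq> n - 1" "Suc i \<noteq> n - 1" "i \<noteq> n - 1" "i - 1 \<noteq> 0" "i \<noteq> 0" using 5 by auto
        then show ?thesis
          using 5 by (simp add: y_def of_nat_diff algebra_simps del: One_nat_def)
      qed
      moreover have "i - 1 \<noteq> Suc i" by simp
      ultimately show ?thesis unfolding row N by (simp add: w del: One_nat_def)
    qed
  qed
  have ne: "pverts (path_graph n) \<noteq> {}"
    and bij: "bij_betw id {..<card (pverts (path_graph n))} (pverts (path_graph n))"
    using n by (auto simp: V lessThan_empty_iff)
  define k where "k = ext_spectral_radius id (path_graph n)"
  obtain x where x: "\<exists>u\<in>{..<n}. x u \<noteq> 0"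
    "\<And>u. u \<in> {..<n} \<Longrightarrow> (\<Sum>w<n. ext_weight (path_graph n) u w * x w) = k * x u"
    using P.ext_eigenvalue_ext_spectral_radius[OF ne bij] unfolding ext_eigenvalue_def V k_def by blast
  obtain i where i: "i \<in> {..<n}" "k * y i \<le> (\<Sum>w<n. ext_weight (path_graph n) i w * y w)"
    by (rule nonneg_kernel_eigenvalue_bound[of "{..<n}" "ext_weight (path_graph n)" y, OF _ _ _ x])
      (auto simp: ext_weight_nonneg ypos)
  then have "k * y i < 2 * y i" using small[of i] by simp
  then show ?thesis using ypos[of i] i by (simp add: k_def)
qed

section \<open>Comparison with the path and the cycle\<close>

theorem theorem4p1:
  fixes G :: "'a pair_pre_digraph" and v :: "nat \<Rightarrow> 'a" and n :: nat
  assumes "pair_graph G" and "Digraph_Component.connected G"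
    and "n \<ge> 5" and "card (pverts G) = n"
    and "bij_betw v {..<n} (pverts G)"
  shows "ext_spectral_radius v G \<ge> ext_spectral_radius id (path_graph n)
    \<and> (ext_spectral_radius v G = ext_spectral_radius id (path_graph n)
         \<longleftrightarrow> digraph_iso G (path_graph n))
    \<and> ext_spectral_radius id (cycle_graph n) = 2
    \<and> (\<not> digraph_iso G (path_graph n) \<longrightarrow>
         ext_spectral_radius v G \<ge> ext_spectral_radius id (cycle_graph n)
         \<and> (ext_spectral_radius v G = ext_spectral_radius id (cycle_graph n)
              \<longleftrightarrow> digraph_iso G (cycle_graph n)))"
proof -
  interpret G: pair_graph G by fact
  have v: "bij_betw v {..<card (pverts G)} (pverts G)" using assms by simp
  have n: "n \<ge> 3" using assms by simp
  have path: "ext_spectral_radius v G = ext_spectral_radius id (path_graph n)"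
    if "digraph_iso G (path_graph n)"
    using assms(1) pair_graph_path_graph that v
    by (rule ext_spectral_radius_iso) (simp add: path_graph_def)
  have cycle: "ext_spectral_radius v G = ext_spectral_radius id (cycle_graph n)"
    if "digraph_iso G (cycle_graph n)"
    using assms(1) pair_graph_cycle_graph[OF n] that v
    by (rule ext_spectral_radius_iso) (simp add: cycle_graph_def)
  note cyc = ext_spectral_radius_cycle_graph[OF n]
  note pth = ext_spectral_radius_path_graph_lt_2[OF assms(3)]
  have "digraph_iso G (path_graph n) \<or> digraph_iso G (cycle_graph n) \<or> ext_spectral_radius v G > 2"
  proof (cases "\<exists>r\<in>pverts G. out_degree G r \<ge> 3")
    case True
    then show ?thesis
      using G.ext_spectral_radius_gt_2[OF assms(2) _ v] assms(4) n by auto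
  next
    case False
    then have "\<And>u. u \<in> pverts G \<Longrightarrow> out_degree G u \<le> 2" by force
    then show ?thesis
      using G.connected_out_degree_le_2_iso[OF assms(2) _ assms(4) n] by blast
  qed
  then consider (P) "digraph_iso G (path_graph n)" | (C) "digraph_iso G (cycle_graph n)"
    | (L) "ext_spectral_radius v G > 2" by blast
  then show ?thesis
  proof cases
    case P
    then show ?thesis using cyc by (simp add: path[OF P])
  next
    case C
    have gt: "ext_spectral_radius v G > ext_spectral_radius id (path_graph n)"
      using cycle[OF C] cyc pth by linarith
    \<comment> \<open>The path is excluded spectrally: an isomorphism would make the two radii
      equal.\<close>
    then have "\<not> digraph_iso G (path_graph n)" using path by fastforce
    then show ?thesis using gt cycle[OF C] cyc C by simp
  next
    case L
    have gt: "ext_spectral_radius v G > ext_spectral_radius id (path_graph n)"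
      using L pth by linarith
    then have "\<not> digraph_iso G (path_graph n)" using path by fastforce
    moreover have "\<not> digraph_iso G (cycle_graph n)" using cycle cyc L by fastforce
    ultimately show ?thesis using gt L cyc by simp
  qed
qed

end
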